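(* Let $X$ be a compact metric space and $f\colon X\to X$ a transitive $n$-expansive homeomorphism with the shadowing property. Then $f$ has the two-sided limit shadowing property with a gap.
   Context: For $x\in X$, $c>0$: $W^s_c(x)=\{y: d(f^k(y),f^k(x))\leq c\ \forall k\geq0\}$, $W^u_c(x)=\{y: d(f^k(y),f^k(x))\leq c\ \forall k\leq0\}$. $f$ is $n$-expansive if there is $c>0$ such that $W^s_c(x)\cap W^u_c(x)$ has at most $n$ points for every $x$. $f$ is transitive if for every nonempty open $U,V$ there is $k\in\mathbb{N}$ with $f^k(U)\cap V\neq\emptyset$. $f$ has the shadowing property if for every $\varepsilon>0$ there is $\delta>0$ such that for every $(x_k)_{k\in\mathbb{Z}}$ with $d(f(x_k),x_{k+1})<\delta$ for all $k$ there is $y$ with $d(f^k(y),x_k)<\varepsilon$ for all $k$. A two-sided limit pseudo orbit is $(x_k)_{k\in\mathbb{Z}}$ with $d(f(x_k),x_{k+1})\to0$ as $|k|\to\infty$. It is two-sided limit shadowed with gap $K\in\mathbb{Z}$ if there is $y\in X$ with $d(f^k(y),x_k)\to0$ as $k\to-\infty$ and $d(f^{K+k}(y),x_k)\to0$ as $k\to\infty$. $f$ has the two-sided limit shadowing property with a gap if there exists $N\in\mathbb{N}$ such that every two-sided limit pseudo orbit is two-sided limit shadowed with some gap $K$ satisfying $|K|\leq N$. *)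

theory Defs
  imports "HOL-Analysis.Analysis"
begin

definition iter_int :: "('a \<Rightarrow> 'a) \<Rightarrow> int \<Rightarrow> 'a \<Rightarrow> 'a" where
  "iter_int f k = (if 0 \<le> k then f ^^ nat k else inv f ^^ nat (- k))"

definition stable_set :: "('a::metric_space \<Rightarrow> 'a) \<Rightarrow> real \<Rightarrow> 'a \<Rightarrow> 'a set" where
  "stable_set f c x = {y. \<forall>k::int. k \<ge> 0 \<longrightarrow> dist (iter_int f k y) (iter_int f k x) \<le> c}"

definition unstable_set :: "('a::metric_space \<Rightarrow> 'a) \<Rightarrow> real \<Rightarrow> 'a \<Rightarrow> 'a set" where
  "unstable_set f c x = {y. \<forall>k::int. k \<le> 0 \<longrightarrow> dist (iter_int f k y) (iter_int f k x) \<le> c}"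

definition n_expansive :: "('a::metric_space \<Rightarrow> 'a) \<Rightarrow> nat \<Rightarrow> bool" where
  "n_expansive f n = (\<exists>c>0. \<forall>x. finite (stable_set f c x \<inter> unstable_set f c x)
                               \<and> card (stable_set f c x \<inter> unstable_set f c x) \<le> n)"

definition transitive_map :: "('a::topological_space \<Rightarrow> 'a) \<Rightarrow> bool" where
  "transitive_map f = (\<forall>U V. open U \<and> open V \<and> U \<noteq> {} \<and> V \<noteq> {} \<longrightarrow>
                          (\<exists>k::nat. (f ^^ k) ` U \<inter> V \<noteq> {}))"

definition shadowing :: "('a::metric_space \<Rightarrow> 'a) \<Rightarrow> bool" where
  "shadowing f = (\<forall>\<epsilon>>0. \<exists>\<delta>>0. \<forall>xs::int \<Rightarrow> 'a.
      (\<forall>k. dist (f (xs k)) (xs (k + 1)) < \<delta>) \<longrightarrow>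
      (\<exists>y. \<forall>k. dist (iter_int f k y) (xs k) < \<epsilon>))"

definition two_sided_limit_pseudo_orbit :: "('a::metric_space \<Rightarrow> 'a) \<Rightarrow> (int \<Rightarrow> 'a) \<Rightarrow> bool" where
  "two_sided_limit_pseudo_orbit f xs =
     (((\<lambda>k. dist (f (xs k)) (xs (k + 1))) \<longlongrightarrow> 0) at_top \<and>
      ((\<lambda>k. dist (f (xs k)) (xs (k + 1))) \<longlongrightarrow> 0) at_bot)"

definition two_sided_limit_shadowed_gap :: "('a::metric_space \<Rightarrow> 'a) \<Rightarrow> (int \<Rightarrow> 'a) \<Rightarrow> int \<Rightarrow> bool" where
  "two_sided_limit_shadowed_gap f xs K =
     (\<exists>y. ((\<lambda>k. dist (iter_int f k y) (xs k)) \<longlongrightarrow> 0) at_bot \<and>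
          ((\<lambda>k. dist (iter_int f (K + k) y) (xs k)) \<longlongrightarrow> 0) at_top)"

definition two_sided_limit_shadowing_gap :: "('a::metric_space \<Rightarrow> 'a) \<Rightarrow> bool" where
  "two_sided_limit_shadowing_gap f =
     (\<exists>N::nat. \<forall>xs. two_sided_limit_pseudo_orbit f xs \<longrightarrow>
        (\<exists>K. \<bar>K\<bar> \<le> int N \<and> two_sided_limit_shadowed_gap f xs K))"

end

theory Submission
  imports Defs
begin

text \<open>A point shadowing a periodic pseudo orbit is periodic, because its dynamical ball is finite.
  Waiting on a periodic orbit of period \<open>q\<close> connects any two points by chains of almost any prescribed
  length, up to an error of at most \<open>q\<close>; this is the gap. It remains to make the orbit shadowing the
  connected pseudo orbit \<open>x\<close> asymptotic to it. An orbit \<open>\<epsilon>\<close>-close to \<open>x\<close> need not be asymptotic to \<open>x\<close>,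
  but if \<open>\<epsilon>\<close> is small (depending on \<open>x\<close>), its distance to \<open>x\<close> has lower limit \<open>0\<close> at both ends, by
  \<open>n\<close>-expansiveness. Hence one can switch from the orbit to \<open>x\<close> with arbitrarily small jumps at
  arbitrarily late times, shadow again with a smaller error, iterate, and pass to the limit.\<close>

section \<open>Limits along integer times, common subsequences, and elimination rules\<close>

lemma filterlim_add_const_at_top_int: "filterlim (\<lambda>k::int. k + a) at_top at_top"
  unfolding filterlim_at_top
proof
  fix Z :: int
  show "\<forall>\<^sub>F k in at_top. Z \<le> k + a"
    using eventually_ge_at_top[of "Z - a"] by (rule eventually_mono) simp
qed

lemma filterlim_int_shift_at_top: "filterlim (\<lambda>i. int i + l) at_top sequentially"
  by (rule filterlim_compose[OF filterlim_add_const_at_top_int filterlim_int_sequentially])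

lemma filterlim_int_shift_at_bot: "filterlim (\<lambda>i. - int i + l) at_bot sequentially"
  unfolding filterlim_at_bot eventually_sequentially
proof
  fix Z :: int
  show "\<exists>N. \<forall>n\<ge>N. - int n + l \<le> Z"
    by (rule exI[of _ "nat (l - Z)"]) auto
qed

text \<open>The sequences are treated one after another: refining the subsequence for the next one
  preserves the limits already found. Finitely many sequences suffice later, so no diagonal argument
  occurs.\<close>

lemma compact_finite_common_subseq:
  fixes s :: "nat \<Rightarrow> nat \<Rightarrow> 'a::metric_space"
  assumes "compact (UNIV :: 'a set)"
  shows "\<exists>r a. strict_mono (r :: nat \<Rightarrow> nat) \<and> (\<forall>j<m. (\<lambda>i. s j (r i)) \<longlonglongrightarrow> a j)"
proof (induction m)
  case 0
  show ?case using strict_mono_id by auto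
next
  case (Suc m)
  then obtain r a where r: "strict_mono r" and a: "\<And>j. j < m \<Longrightarrow> (\<lambda>i. s j (r i)) \<longlonglongrightarrow> a j"
    by auto
  obtain b t where t: "strict_mono t" and b: "(\<lambda>i. s m (r (t i))) \<longlonglongrightarrow> b"
    using assms[unfolded compact_def, rule_format, of "\<lambda>i. s m (r i)"] by (auto simp: o_def)
  have "(\<lambda>i. s j (r (t i))) \<longlonglongrightarrow> (a(m := b)) j" if "j < Suc m" for j
    using that b LIMSEQ_subseq_LIMSEQ[OF a t, of j] by (cases "j = m") (auto simp: o_def)
  moreover have "strict_mono (\<lambda>i. r (t i))"
    using strict_mono_compose[OF r t] .
  ultimately show ?case by blast
qed

lemma shadowingE:
  assumes "shadowing f" "\<epsilon> > 0"
  obtains \<delta> where "\<delta> > 0" "\<And>w. (\<And>k. dist (f (w k)) (w (k + 1)) < \<delta>) \<Longrightarrow>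
    \<exists>y. \<forall>k. dist (iter_int f k y) (w k) < \<epsilon>"
  using assms unfolding shadowing_def by blast

lemma two_sided_limit_pseudo_orbitE:
  assumes "two_sided_limit_pseudo_orbit f x" "\<delta> > 0"
  obtains A B where "\<And>k. k \<le> A \<Longrightarrow> dist (f (x k)) (x (k + 1)) < \<delta>"
    "\<And>k. k \<ge> B \<Longrightarrow> dist (f (x k)) (x (k + 1)) < \<delta>"
proof -
  have "\<forall>\<^sub>F k in at_bot. dist (f (x k)) (x (k + 1)) < \<delta>" "\<forall>\<^sub>F k in at_top. dist (f (x k)) (x (k + 1)) < \<delta>"
    using assms order_tendstoD(2) unfolding two_sided_limit_pseudo_orbit_def by blast+
  then show ?thesis
    using that unfolding eventually_at_bot_linorder eventually_at_top_linorder by blast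
qed

section \<open>Finite pseudo orbits between two points\<close>

text \<open>The length \<open>l\<close> counts jumps, not points, so lengths add under concatenation
  and a chain of length 0 forces \<open>a = b\<close>.\<close>

definition pseudo_chain :: "('a::metric_space \<Rightarrow> 'a) \<Rightarrow> real \<Rightarrow> nat \<Rightarrow> 'a \<Rightarrow> 'a \<Rightarrow> bool" where
  "pseudo_chain f \<delta> l a b \<longleftrightarrow>
     (\<exists>c. c 0 = a \<and> c l = b \<and> (\<forall>i<l. dist (f (c i)) (c (Suc i)) < \<delta>))"

lemma pseudo_chain_trans:
  assumes "pseudo_chain f \<delta> l a b" "pseudo_chain f \<delta> m b c"
  shows "pseudo_chain f \<delta> (l + m) a c"
proof -
  obtain u where u: "u 0 = a" "u l = b" "\<And>i. i < l \<Longrightarrow> dist (f (u i)) (u (Suc i)) < \<delta>"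
    using assms(1) unfolding pseudo_chain_def by blast
  obtain v where v: "v 0 = b" "v m = c" "\<And>i. i < m \<Longrightarrow> dist (f (v i)) (v (Suc i)) < \<delta>"
    using assms(2) unfolding pseudo_chain_def by blast
  define w where "w i = (if i < l then u i else v (i - l))" for i
  have "dist (f (w i)) (w (Suc i)) < \<delta>" if "i < l + m" for i
  proof -
    consider "Suc i < l" | "Suc i = l" | "l \<le> i" by linarith
    then show ?thesis
    proof cases
      case 1
      then show ?thesis using u(3)[of i] by (simp add: w_def)
    next
      case 2
      then show ?thesis using u(3)[of i] u(2) v(1) by (auto simp: w_def)
    next
      case 3
      then show ?thesis using v(3)[of "i - l"] that by (simp add: w_def Suc_diff_le)
    qed
  qed
  moreover have "w 0 = a" using u(1,2) v(1) by (auto simp: w_def)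
  moreover have "w (l + m) = c" using v(2) by (simp add: w_def)
  ultimately show ?thesis unfolding pseudo_chain_def by blast
qed

lemma pseudo_chain_loops:
  assumes "pseudo_chain f \<delta> l a a"
  shows "pseudo_chain f \<delta> (j * l) a a"
proof (induction j)
  case 0
  then show ?case by (auto simp: pseudo_chain_def)
next
  case (Suc j)
  then show ?case using pseudo_chain_trans[OF assms Suc] by simp
qed

lemma pseudo_chain_orbit:
  assumes "(f ^^ l) a = b" "0 < \<delta>"
  shows "pseudo_chain f \<delta> l a b"
  unfolding pseudo_chain_def using assms by (intro exI[of _ "\<lambda>i. (f ^^ i) a"]) auto

text \<open>The conclusion says that the distance has lower limit 0 along \<open>F\<close>. The
  filter \<open>F\<close> stands for either end of the integers, and the radius may depend on the
  sequence \<open>x\<close>.\<close>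

definition recurrence_radius ::
    "('a::metric_space \<Rightarrow> 'a) \<Rightarrow> int filter \<Rightarrow> (int \<Rightarrow> 'a) \<Rightarrow> real \<Rightarrow> bool" where
  "recurrence_radius f F x e \<longleftrightarrow>
     (\<forall>y. (\<forall>\<^sub>F k in F. dist (iter_int f k y) (x k) \<le> e) \<longrightarrow>
          (\<forall>\<eta>>0. \<exists>\<^sub>F k in F. dist (iter_int f k y) (x k) < \<eta>))"

lemma recurrence_radius_mono:
  assumes "recurrence_radius f F x e" "e' \<le> e"
  shows "recurrence_radius f F x e'"
  unfolding recurrence_radius_def
proof (intro allI impI)
  fix y and \<eta> :: real
  assume "\<forall>\<^sub>F k in F. dist (iter_int f k y) (x k) \<le> e'" and "0 < \<eta>"
  moreover from this(1) have "\<forall>\<^sub>F k in F. dist (iter_int f k y) (x k) \<le> e"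
    by (rule eventually_mono) (use assms(2) in simp)
  ultimately show "\<exists>\<^sub>F k in F. dist (iter_int f k y) (x k) < \<eta>"
    using assms(1) unfolding recurrence_radius_def by blast
qed

section \<open>Integer iterates of a homeomorphism of a compact space\<close>

locale compact_homeo =
  fixes f :: "'a::metric_space \<Rightarrow> 'a"
  assumes compact_UNIV: "compact (UNIV :: 'a set)"
    and homeo: "\<exists>g. homeomorphism UNIV UNIV f g"
begin

lemma bij_f: "bij f"
proof -
  obtain g where "homeomorphism UNIV UNIV f g" using homeo by blast
  then have "g \<circ> f = id" "f \<circ> g = id" by (auto simp: homeomorphism_def)
  then show ?thesis by (rule o_bij)
qed

lemma continuous_f: "continuous_on UNIV f"
  using homeo unfolding homeomorphism_def by blast

lemma continuous_inv_f: "continuous_on UNIV (inv f)"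
proof -
  obtain g where g: "homeomorphism UNIV UNIV f g" using homeo by blast
  then have "inv f = g"
    by (intro inv_equality) (auto simp: homeomorphism_def)
  with g show ?thesis by (auto simp: homeomorphism_def)
qed

lemma iter_int_0: "iter_int f 0 x = x"
  by (simp add: iter_int_def)

lemma iter_int_of_nat: "iter_int f (int m) x = (f ^^ m) x"
  by (simp add: iter_int_def)

lemma iter_int_succ: "iter_int f (k + 1) x = f (iter_int f k x)"
proof (cases "0 \<le> k")
  case True
  then have "nat (k + 1) = Suc (nat k)" by simp
  with True show ?thesis by (simp add: iter_int_def)
next
  case False
  then have "nat (- k) = Suc (nat (- (k + 1)))" by simp
  with False show ?thesis
    using bij_f by (auto simp: iter_int_def bij_is_surj surj_f_inv_f)
qed

lemma iter_int_pred: "iter_int f (k - 1) x = inv f (iter_int f k x)"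
  using iter_int_succ[of "k - 1" x] bij_f by (simp add: bij_is_inj)

lemma iter_int_add: "iter_int f (k + l) x = iter_int f k (iter_int f l x)"
proof (induction k rule: int_induct[where k = 0])
  case base
  then show ?case by (simp add: iter_int_0)
next
  case (step1 i)
  then show ?case using iter_int_succ[of "i + l" x] iter_int_succ[of i] by (simp add: ac_simps)
next
  case (step2 i)
  have "i - 1 + l = i + l - 1" by simp
  then show ?case using step2 by (simp only: iter_int_pred)
qed

lemma continuous_iter_int: "continuous_on UNIV (iter_int f k)"
proof (induction k rule: int_induct[where k = 0])
  case base
  then show ?case by (simp add: iter_int_0[abs_def])
next
  case (step1 i)
  then show ?case
    by (simp only: iter_int_succ[abs_def] continuous_on_compose2[OF continuous_f] subset_UNIV)
next
  case (step2 i)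
  then show ?case
    by (simp only: iter_int_pred[abs_def] continuous_on_compose2[OF continuous_inv_f] subset_UNIV)
qed

lemma tendsto_iter_int:
  assumes "s \<longlonglongrightarrow> a"
  shows "(\<lambda>i. iter_int f k (s i)) \<longlonglongrightarrow> iter_int f k a"
  by (rule continuous_on_tendsto_compose[OF continuous_iter_int assms]) auto

section \<open>Recurrence of orbits that stay close to a given sequence\<close>

text \<open>Replacing \<open>y\<close> by its \<open>K\<close>-th iterate turns closeness to
  \<open>x'\<close> into closeness to \<open>x\<close> at late times. This is needed because the
  connected pseudo orbit follows \<open>x\<close> with a delay at its forward end.\<close>

lemma recurrence_radius_shift:
  assumes "recurrence_radius f at_top x e"
    and "\<forall>\<^sub>F k in at_top. x' (k + K) = x k"
  shows "recurrence_radius f at_top x' e"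
  unfolding recurrence_radius_def
proof (intro allI impI)
  fix y and \<eta> :: real
  assume "\<forall>\<^sub>F k in at_top. dist (iter_int f k y) (x' k) \<le> e" and "0 < \<eta>"
  then have "\<forall>\<^sub>F k in at_top. dist (iter_int f (k + K) y) (x' (k + K)) \<le> e"
    using eventually_compose_filterlim filterlim_add_const_at_top_int by blast
  with assms(2) have "\<forall>\<^sub>F k in at_top. dist (iter_int f k (iter_int f K y)) (x k) \<le> e"
    by eventually_elim (simp add: iter_int_add)
  with assms(1) \<open>0 < \<eta>\<close>
  have fr: "\<exists>\<^sub>F k in at_top. dist (iter_int f k (iter_int f K y)) (x k) < \<eta>"
    unfolding recurrence_radius_def by blast
  show "\<exists>\<^sub>F k in at_top. dist (iter_int f k y) (x' k) < \<eta>"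
  proof (rule ccontr)
    assume "\<not> ?thesis"
    then have "\<forall>\<^sub>F k in at_top. \<not> dist (iter_int f k y) (x' k) < \<eta>"
      by (simp add: frequently_def)
    then have "\<forall>\<^sub>F k in at_top. \<not> dist (iter_int f (k + K) y) (x' (k + K)) < \<eta>"
      using eventually_compose_filterlim filterlim_add_const_at_top_int by blast
    with assms(2) have "\<forall>\<^sub>F k in at_top. \<not> dist (iter_int f k (iter_int f K y)) (x k) < \<eta>"
      by eventually_elim (simp add: iter_int_add)
    with fr show False by (simp add: frequently_def)
  qed
qed

text \<open>If no radius worked, there would be orbits \<open>y\<^sub>0, y\<^sub>1, \<dots>\<close>, each one trapped in an annulus around
  \<open>x\<close>, with disjoint annuli shrinking to \<open>x\<close>. Limit points of these orbits taken along common times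
  are distinct and lie in the same dynamical ball, which contradicts \<open>n\<close>-expansiveness.\<close>
lemma n_expansive_recurrence_radius:
  fixes x :: "int \<Rightarrow> 'a"
  assumes "n_expansive f n"
    and \<sigma>: "\<And>l. filterlim (\<lambda>i. \<sigma> i + l) F sequentially"
  shows "\<exists>e>0. recurrence_radius f F x e"
proof (rule ccontr)
  assume contr: "\<not> ?thesis"
  obtain c where c: "c > 0"
    "\<And>x. finite (stable_set f c x \<inter> unstable_set f c x)"
    "\<And>x. card (stable_set f c x \<inter> unstable_set f c x) \<le> n"
    using assms(1) unfolding n_expansive_def by blast
  \<comment> \<open>Failure of the radius \<open>e\<close> yields an orbit that finally lies in an
    annulus around \<open>x\<close> with outer radius \<open>e\<close> and inner radius
    \<eta>.\<close>
  define trapped where "trapped e y \<eta> \<longleftrightarrow> (\<forall>\<^sub>F k in F. dist (iter_int f k y) (x k) \<le> e) \<and> \<eta> > 0 \<and>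
    (\<forall>\<^sub>F k in F. \<eta> \<le> dist (iter_int f k y) (x k))" for e y \<eta>
  have "\<exists>y \<eta>. trapped e y \<eta>" if "e > 0" for e
  proof -
    have "\<not> recurrence_radius f F x e" using contr that by blast
    then obtain y \<eta> where "\<forall>\<^sub>F k in F. dist (iter_int f k y) (x k) \<le> e" "\<eta> > 0"
      "\<not> (\<exists>\<^sub>F k in F. dist (iter_int f k y) (x k) < \<eta>)"
      unfolding recurrence_radius_def by blast
    then have "trapped e y \<eta>" by (simp add: trapped_def frequently_def not_less)
    then show ?thesis by blast
  qed
  then obtain Y H where "\<And>e. e > 0 \<Longrightarrow> trapped e (Y e) (H e)"
    by metis
  then have YH: "\<And>e. e > 0 \<Longrightarrow> \<forall>\<^sub>F k in F. dist (iter_int f k (Y e)) (x k) \<le> e"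
    "\<And>e. e > 0 \<Longrightarrow> H e > 0" "\<And>e. e > 0 \<Longrightarrow> \<forall>\<^sub>F k in F. H e \<le> dist (iter_int f k (Y e)) (x k)"
    unfolding trapped_def by blast+
  \<comment> \<open>Starting at \<open>c / 2\<close> keeps any two of the chosen orbits eventually
    \<open>c\<close>-close. Taking each new outer radius at most half of the previous inner radius
    \<open>H (e j)\<close> keeps them eventually at least \<open>H (e i) / 2\<close> apart, where
    \<open>i\<close> is the smaller index.\<close>
  define e where "e = rec_nat (c / 2) (\<lambda>_ e. min e (H e / 2))"
  have e_0: "e 0 = c / 2" and e_Suc: "e (Suc j) = min (e j) (H (e j) / 2)" for j
    by (simp_all add: e_def)
  have e_pos: "e j > 0" for j
    by (induction j) (use c(1) YH(2) in \<open>auto simp: e_0 e_Suc\<close>)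
  have e_anti: "antimono e"
    by (rule decseq_SucI) (simp add: e_Suc)
  define y where "y j = Y (e j)" for j
  have close: "\<forall>\<^sub>F k in F. dist (iter_int f k (y i)) (iter_int f k (y j)) \<le> c" for i j
  proof -
    have "\<forall>\<^sub>F k in F. dist (iter_int f k (y m)) (x k) \<le> c / 2" for m
      using YH(1)[OF e_pos[of m]] antimonoD[OF e_anti, of 0 m]
      by (auto simp: y_def e_0 elim: eventually_mono)
    from this[of i] this[of j] show ?thesis
    proof eventually_elim
      case (elim k)
      then show ?case
        using dist_triangle3[of "iter_int f k (y i)" "iter_int f k (y j)" "x k"]
        by (simp add: dist_commute)
    qed
  qed
  have apart: "\<forall>\<^sub>F k in F. H (e i) / 2 \<le> dist (iter_int f k (y i)) (iter_int f k (y j))"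
    if "i < j" for i j
  proof -
    have le: "e j \<le> H (e i) / 2"
      using antimonoD[OF e_anti, of "Suc i" j] that by (simp add: e_Suc)
    from YH(1)[OF e_pos[of j]] YH(3)[OF e_pos[of i]] show ?thesis
      unfolding y_def[symmetric]
    proof eventually_elim
      case (elim k)
      then show ?case
        using le dist_triangle[of "iter_int f k (y i)" "x k" "iter_int f k (y j)"] by linarith
    qed
  qed
  obtain r a where r: "strict_mono (r :: nat \<Rightarrow> nat)"
    and a: "\<And>j. j < Suc n \<Longrightarrow> (\<lambda>i. iter_int f (\<sigma> (r i)) (y j)) \<longlonglongrightarrow> a j"
    using compact_finite_common_subseq[OF compact_UNIV, of "Suc n" "\<lambda>j i. iter_int f (\<sigma> i) (y j)"]
    by blast
  \<comment> \<open>For each fixed \<open>l\<close> the shifted times still tend along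
    \<open>F\<close>. Hence bounds known only eventually along \<open>F\<close> pass to the limit
    points at every integer time \<open>l\<close>, past and future alike.\<close>
  have \<sigma>r: "filterlim (\<lambda>i. l + \<sigma> (r i)) F sequentially" for l
    using filterlim_compose[OF \<sigma> filterlim_subseq[OF r], of l] by (simp add: add.commute)
  have dist_lim: "(\<lambda>m. dist (iter_int f (l + \<sigma> (r m)) (y i)) (iter_int f (l + \<sigma> (r m)) (y j)))
      \<longlonglongrightarrow> dist (iter_int f l (a i)) (iter_int f l (a j))" if "i < Suc n" "j < Suc n" for i j l
    unfolding iter_int_add using that by (intro tendsto_dist tendsto_iter_int a)
  have "a j \<in> stable_set f c (a 0) \<inter> unstable_set f c (a 0)" if "j < Suc n" for j
  proof -
    have "dist (iter_int f l (a j)) (iter_int f l (a 0)) \<le> c" for l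
      by (rule tendsto_upperbound[OF dist_lim[of j 0 l]])
        (use that eventually_compose_filterlim[OF close \<sigma>r] in auto)
    then show ?thesis by (simp add: stable_set_def unstable_set_def)
  qed
  then have "a ` {..<Suc n} \<subseteq> stable_set f c (a 0) \<inter> unstable_set f c (a 0)"
    by blast
  then have "card (a ` {..<Suc n}) \<le> n"
    using c(2,3) card_mono order_trans by meson
  moreover have "inj_on a {..<Suc n}"
  proof (rule linorder_inj_onI')
    fix i j assume ij: "i \<in> {..<Suc n}" "j \<in> {..<Suc n}" "i < j"
    have "H (e i) / 2 \<le> dist (iter_int f 0 (a i)) (iter_int f 0 (a j))"
      by (rule tendsto_lowerbound[OF dist_lim[of i j 0]])
        (use ij eventually_compose_filterlim[OF apart[OF ij(3)] \<sigma>r[of 0]] in auto)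
    with YH(2)[OF e_pos[of i]] show "a i \<noteq> a j" by auto
  qed
  ultimately show False by (simp add: card_image)
qed

section \<open>From recurrence to limit shadowing by repeated splicing\<close>

text \<open>The sequence that follows \<open>x\<close> before time \<open>a\<close>, the orbit of
  \<open>y\<close> on \<open>[a, b)\<close> and \<open>x\<close> again from \<open>b\<close> on is
  shadowed. Recurrence supplies switching times so far out that \<open>x\<close> itself has small
  jumps beyond them.\<close>

lemma splice_step:
  fixes x :: "int \<Rightarrow> 'a"
  assumes "shadowing f"
    and po: "two_sided_limit_pseudo_orbit f x"
    and rad: "recurrence_radius f at_top x e" "recurrence_radius f at_bot x e"
    and y: "\<forall>\<^sub>F k in at_top. dist (iter_int f k y) (x k) \<le> e"
      "\<forall>\<^sub>F k in at_bot. dist (iter_int f k y) (x k) \<le> e"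
    and "\<epsilon> > 0"
  shows "\<exists>y' a b. (\<forall>k. a \<le> k \<and> k < b \<longrightarrow> dist (iter_int f k y') (iter_int f k y) < \<epsilon>) \<and>
                  (\<forall>k. \<not> (a \<le> k \<and> k < b) \<longrightarrow> dist (iter_int f k y') (x k) < \<epsilon>)"
proof -
  obtain \<delta> where "\<delta> > 0" and \<delta>: "\<And>w. (\<And>k. dist (f (w k)) (w (k + 1)) < \<delta>) \<Longrightarrow>
      \<exists>y. \<forall>k. dist (iter_int f k y) (w k) < \<epsilon>"
    by (rule shadowingE[OF assms(1) \<open>\<epsilon> > 0\<close>]) blast
  then have "\<delta> / 2 > 0" by simp
  obtain A B where A: "\<And>k. k \<le> A \<Longrightarrow> dist (f (x k)) (x (k + 1)) < \<delta> / 2"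
    and B: "\<And>k. k \<ge> B \<Longrightarrow> dist (f (x k)) (x (k + 1)) < \<delta> / 2"
    by (rule two_sided_limit_pseudo_orbitE[OF po \<open>\<delta> / 2 > 0\<close>]) blast
  have "\<exists>\<^sub>F k in at_top. dist (iter_int f k y) (x k) < \<delta> / 2"
    using rad(1) y(1) \<open>\<delta> / 2 > 0\<close> unfolding recurrence_radius_def by blast
  \<comment> \<open>The bounds 1 here and 0 for \<open>a\<close> below guarantee
    \<open>a < b\<close>.\<close>
  from frequently_eventually_frequently[OF this eventually_ge_at_top[of "max B 1"]]
  obtain b where b: "dist (iter_int f b y) (x b) < \<delta> / 2" "b \<ge> B" "b \<ge> 1"
    by (auto dest: frequently_ex)
  have "\<exists>\<^sub>F k in at_bot. dist (iter_int f k y) (x k) < \<delta> / 2"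
    using rad(2) y(2) \<open>\<delta> / 2 > 0\<close> unfolding recurrence_radius_def by blast
  from frequently_eventually_frequently[OF this eventually_le_at_bot[of "min A 0"]]
  obtain a where a: "dist (iter_int f a y) (x a) < \<delta> / 2" "a \<le> A" "a \<le> 0"
    by (auto dest: frequently_ex)
  define w where "w k = (if a \<le> k \<and> k < b then iter_int f k y else x k)" for k
  have "dist (f (w k)) (w (k + 1)) < \<delta>" for k
  proof -
    \<comment> \<open>The seam at \<open>a\<close> costs twice \<delta>/2: one jump of
      \<open>x\<close>, then the passage from \<open>x a\<close> to the orbit. The seam at
      \<open>b\<close> costs only the passage from the orbit to \<open>x b\<close>.\<close>
    consider "k + 1 < a" | "k + 1 = a" | "a \<le> k" "k + 1 < b" | "k + 1 = b" | "b \<le> k"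
      by linarith
    then show ?thesis
    proof cases
      case 1
      then show ?thesis using A[of k] a \<open>\<delta> > 0\<close> by (simp add: w_def)
    next
      case 2
      then have "dist (f (x k)) (x a) < \<delta> / 2" using A[of k] a by simp
      then show ?thesis
        using 2 a b dist_triangle_half_l[of "f (x k)" "x a" \<delta> "iter_int f a y"]
        by (auto simp: w_def dist_commute)
    next
      case 3
      then show ?thesis using \<open>\<delta> > 0\<close> by (simp add: w_def iter_int_succ)
    next
      case 4
      then show ?thesis
        using b a \<open>\<delta> > 0\<close> iter_int_succ[of k y] by (auto simp: w_def)
    next
      case 5
      then show ?thesis using B[of k] b a \<open>\<delta> > 0\<close> by (simp add: w_def)
    qed
  qed
  from \<delta>[of w, OF this] obtain y' where y': "\<And>k. dist (iter_int f k y') (w k) < \<epsilon>" by blast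
  have "dist (iter_int f k y') (iter_int f k y) < \<epsilon>" if "a \<le> k \<and> k < b" for k
    using y'[of k] that by (simp add: w_def)
  moreover have "dist (iter_int f k y') (x k) < \<epsilon>" if "\<not> (a \<le> k \<and> k < b)" for k
    using y'[of k] that by (simp add: w_def)
  ultimately show ?thesis by blast
qed

text \<open>Splicing is iterated with errors \<open>e / 2 ^ j\<close>. At a time outside window
  \<open>j\<close>, \<open>y (Suc j)\<close> is within \<open>e / 2 ^ j\<close> of \<open>x\<close>;
  each later stage \<open>m\<close> either moves the orbit by less than \<open>e / 2 ^ m\<close>
  there or puts it that close to \<open>x\<close> anew. The errors sum geometrically, so a limit
  point of the \<open>y j\<close> is within \<open>2 * e / 2 ^ j\<close> of \<open>x\<close> outside
  a bounded window, for every \<open>j\<close>.\<close>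

lemma limit_shadowing_of_recurrence_radius:
  fixes x :: "int \<Rightarrow> 'a"
  assumes "shadowing f" "two_sided_limit_pseudo_orbit f x" "e > 0"
    and rad: "recurrence_radius f at_top x e" "recurrence_radius f at_bot x e"
    and y0: "\<forall>\<^sub>F k in at_top. dist (iter_int f k y0) (x k) \<le> e"
      "\<forall>\<^sub>F k in at_bot. dist (iter_int f k y0) (x k) \<le> e"
  shows "\<exists>y. ((\<lambda>k. dist (iter_int f k y) (x k)) \<longlongrightarrow> 0) at_bot \<and>
             ((\<lambda>k. dist (iter_int f k y) (x k)) \<longlongrightarrow> 0) at_top"
proof -
  define near where "near y \<longleftrightarrow> (\<forall>\<^sub>F k in at_top. dist (iter_int f k y) (x k) \<le> e) \<and>
    (\<forall>\<^sub>F k in at_bot. dist (iter_int f k y) (x k) \<le> e)" for y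
  define splice where "splice \<epsilon> y y' a b \<longleftrightarrow>
    (\<forall>k. a \<le> k \<and> k < b \<longrightarrow> dist (iter_int f k y') (iter_int f k y) < \<epsilon>) \<and>
    (\<forall>k. \<not> (a \<le> k \<and> k < b) \<longrightarrow> dist (iter_int f k y') (x k) < \<epsilon>)" for \<epsilon> y y' a b
  have step: "\<exists>y'. near y' \<and> (\<exists>a b. splice (e / 2 ^ j) y y' a b)" if y: "near y" for y j
  proof -
    have "e / 2 ^ j > 0" using \<open>e > 0\<close> by simp
    then obtain y' a b where s: "splice (e / 2 ^ j) y y' a b"
      using splice_step[OF assms(1,2) rad, of y, folded splice_def] y
      unfolding near_def by blast
    \<comment> \<open>The new orbit stays \<open>e\<close>-close to \<open>x\<close> at both ends,
      so recurrence applies to it again.\<close>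
    have "e / 2 ^ j \<le> e" using \<open>e > 0\<close> by (simp add: field_simps)
    then have le: "dist (iter_int f k y') (x k) \<le> e" if "\<not> (a \<le> k \<and> k < b)" for k
      using s that unfolding splice_def by (meson less_imp_le less_le_trans)
    have "\<forall>\<^sub>F k in at_top. dist (iter_int f k y') (x k) \<le> e"
      by (rule eventually_mono[OF eventually_ge_at_top[of b] le]) auto
    moreover have "\<forall>\<^sub>F k in at_bot. dist (iter_int f k y') (x k) \<le> e"
      by (rule eventually_mono[OF eventually_le_at_bot[of "a - 1"] le]) auto
    ultimately show ?thesis using s unfolding near_def by blast
  qed
  have "\<exists>y. \<forall>j. near (y j) \<and> (\<exists>a b. splice (e / 2 ^ j) (y j) (y (Suc j)) a b)"
    using dependent_nat_choice[of "\<lambda>_. near" "\<lambda>j y y'. \<exists>a b. splice (e / 2 ^ j) y y' a b"]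
      step y0 unfolding near_def by blast
  then obtain y a b where spl: "\<And>j. splice (e / 2 ^ j) (y j) (y (Suc j)) (a j) (b j)"
    by metis
  \<comment> \<open>The right-hand side is the closed form of the sum of \<open>e / 2 ^ i\<close>
    over \<open>j \<le> i < m\<close>.\<close>
  have bound: "dist (iter_int f k (y m)) (x k) \<le> 4 * e / 2 ^ Suc j - 2 * e / 2 ^ m"
    if "Suc j \<le> m" and k: "\<not> (a j \<le> k \<and> k < b j)" for j m k
    using that(1)
  proof (induction m rule: dec_induct)
    case base
    have "4 * e / 2 ^ Suc j - 2 * e / 2 ^ Suc j = e / 2 ^ j" by simp
    then show ?case using spl[of j] k unfolding splice_def by (metis less_imp_le)
  next
    case (step m)
    have eq: "2 * e / 2 ^ Suc m = e / 2 ^ m" by simp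
    show ?case
    proof (cases "a m \<le> k \<and> k < b m")
      case True
      then have "dist (iter_int f k (y (Suc m))) (iter_int f k (y m)) < e / 2 ^ m"
        using spl[of m] unfolding splice_def by blast
      then show ?thesis
        using step.IH eq
          dist_triangle[of "iter_int f k (y (Suc m))" "x k" "iter_int f k (y m)"] by linarith
    next
      case False
      then have "dist (iter_int f k (y (Suc m))) (x k) < e / 2 ^ m"
        using spl[of m] unfolding splice_def by blast
      moreover have "e / 2 ^ m \<le> e / 2 ^ Suc j"
        using \<open>e > 0\<close> step.hyps by (intro divide_left_mono power_increasing) auto
      moreover have "e / 2 ^ m \<ge> 0" "4 * e / 2 ^ Suc j = 4 * (e / 2 ^ Suc j)"
        using \<open>e > 0\<close> by auto
      ultimately show ?thesis using eq by linarith
    qed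
  qed
  obtain r z where r: "strict_mono (r :: nat \<Rightarrow> nat)" and z: "(\<lambda>i. y (r i)) \<longlonglongrightarrow> z"
    using compact_UNIV[unfolded compact_def, rule_format, of y] by (auto simp: o_def)
  have z_bound: "dist (iter_int f k z) (x k) \<le> 2 * e / 2 ^ j" if "\<not> (a j \<le> k \<and> k < b j)" for j k
  proof (rule tendsto_upperbound[OF tendsto_dist[OF tendsto_iter_int[OF z] tendsto_const]])
    have "dist (iter_int f k (y (r i))) (x k) \<le> 2 * e / 2 ^ j" if "i \<ge> Suc j" for i
    proof -
      have "r i \<ge> Suc j" using that seq_suble[OF r, of i] by linarith
      moreover have "4 * e / 2 ^ Suc j = 2 * e / 2 ^ j" "2 * e / 2 ^ r i \<ge> 0"
        using \<open>e > 0\<close> by auto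
      ultimately show ?thesis
        using bound[of j "r i" k] \<open>\<not> (a j \<le> k \<and> k < b j)\<close> by linarith
    qed
    then show "\<forall>\<^sub>F i in sequentially. dist (iter_int f k (y (r i))) (x k) \<le> 2 * e / 2 ^ j"
      unfolding eventually_sequentially by blast
  qed simp
  have small: "\<exists>j. 2 * e / 2 ^ j < \<eta>" if "\<eta> > 0" for \<eta>
  proof -
    have "(\<lambda>j. 2 * e / 2 ^ j) \<longlonglongrightarrow> 0"
      by (rule LIMSEQ_divide_realpow_zero) simp
    then show ?thesis
      using order_tendstoD(2)[OF _ that] eventually_happens sequentially_bot by blast
  qed
  have lim: "((\<lambda>k. dist (iter_int f k z) (x k)) \<longlongrightarrow> 0) F"
    if "\<And>j. \<forall>\<^sub>F k in F. \<not> (a j \<le> k \<and> k < b j)" for F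
  proof (rule tendstoI)
    fix \<eta> :: real assume "\<eta> > 0"
    then obtain j where "2 * e / 2 ^ j < \<eta>" using small by blast
    with z_bound[of j] have "dist (iter_int f k z) (x k) < \<eta>" if "\<not> (a j \<le> k \<and> k < b j)" for k
      using that by (meson le_less_trans)
    with that[of j] show "\<forall>\<^sub>F k in F. dist (dist (iter_int f k z) (x k)) 0 < \<eta>"
      by (auto elim!: eventually_mono)
  qed
  have "((\<lambda>k. dist (iter_int f k z) (x k)) \<longlongrightarrow> 0) at_bot"
  proof (rule lim)
    show "\<forall>\<^sub>F k in at_bot. \<not> (a j \<le> k \<and> k < b j)" for j
      using eventually_le_at_bot[of "a j - 1"] by (rule eventually_mono) auto
  qed
  moreover have "((\<lambda>k. dist (iter_int f k z) (x k)) \<longlongrightarrow> 0) at_top"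
  proof (rule lim)
    show "\<forall>\<^sub>F k in at_top. \<not> (a j \<le> k \<and> k < b j)" for j
      using eventually_ge_at_top[of "b j"] by (rule eventually_mono) auto
  qed
  ultimately show ?thesis by blast
qed

section \<open>Chains from transitivity, a periodic point, and chains of prescribed length\<close>

text \<open>Finitely many small balls cover the space, and transitivity joins any two of them by an
  orbit segment; the maximum over these pairs bounds the lengths uniformly. One jump enters the
  segment near \<open>f a\<close> and one leaves it near \<open>inv f b\<close>, which accounts for
  the \<open>+ 2\<close> in \<open>L\<close>.\<close>

lemma transitive_bounded_pseudo_chains:
  assumes "transitive_map f" "\<delta> > 0"
  shows "\<exists>L. \<forall>a b. \<exists>l. 1 \<le> l \<and> l \<le> L \<and> pseudo_chain f \<delta> l a b"
proof -
  have "uniformly_continuous_on UNIV f"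
    by (rule compact_uniformly_continuous[OF continuous_f compact_UNIV])
  then obtain \<eta>0 where "\<eta>0 > 0" and \<eta>0: "\<And>u v. dist u v < \<eta>0 \<Longrightarrow> dist (f u) (f v) < \<delta>"
    using \<open>\<delta> > 0\<close> unfolding uniformly_continuous_on_def by (meson UNIV_I)
  \<comment> \<open>The entering jump needs \<eta> \<le> \<delta>. The leaving jump is measured
    after applying \<open>f\<close>, so it needs the modulus \<open>\<eta>0\<close> of uniform
    continuity.\<close>
  define \<eta> where "\<eta> = min \<delta> \<eta>0"
  have "\<eta> > 0" using \<open>\<delta> > 0\<close> \<open>\<eta>0 > 0\<close> by (simp add: \<eta>_def)
  then obtain C where "finite C" and C: "(UNIV :: 'a set) \<subseteq> (\<Union>s\<in>C. ball s (\<eta> / 2))"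
    using compact_UNIV half_gt_zero unfolding compact_eq_totally_bounded by blast
  have "\<exists>k. (f ^^ k) ` ball s (\<eta> / 2) \<inter> ball t (\<eta> / 2) \<noteq> {}" for s t
    using assms(1) \<open>\<eta> > 0\<close> unfolding transitive_map_def by simp
  then obtain k where k: "\<And>s t. (f ^^ k s t) ` ball s (\<eta> / 2) \<inter> ball t (\<eta> / 2) \<noteq> {}"
    by metis
  define L where "L = Max ((\<lambda>(s, t). k s t) ` (C \<times> C)) + 2"
  have "\<exists>l. 1 \<le> l \<and> l \<le> L \<and> pseudo_chain f \<delta> l a b" for a b
  proof -
    have cover: "\<exists>s\<in>C. dist s v < \<eta> / 2" for v
      using C by (auto dest!: subsetD[of UNIV _ v])
    obtain s where s: "s \<in> C" "dist s (f a) < \<eta> / 2" using cover by blast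
    obtain t where t: "t \<in> C" "dist t (inv f b) < \<eta> / 2" using cover by blast
    obtain u where u: "dist s u < \<eta> / 2" "dist t ((f ^^ k s t) u) < \<eta> / 2"
      using k[of s t] by auto
    have "dist (f a) u < \<delta>"
      using s u dist_triangle_half_r[of s "f a" \<eta> u] by (simp add: \<eta>_def)
    then have 1: "pseudo_chain f \<delta> 1 a u"
      unfolding pseudo_chain_def by (intro exI[of _ "\<lambda>i. if i = 0 then a else u"]) auto
    have "dist ((f ^^ k s t) u) (inv f b) < \<eta>0"
      using t u dist_triangle_half_r[of t _ \<eta>] by (simp add: \<eta>_def)
    then have "dist (f ((f ^^ k s t) u)) b < \<delta>"
      using \<eta>0[of "(f ^^ k s t) u" "inv f b"] bij_f by (simp add: bij_is_surj surj_f_inv_f)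
    then have 2: "pseudo_chain f \<delta> 1 ((f ^^ k s t) u) b"
      unfolding pseudo_chain_def
      by (intro exI[of _ "\<lambda>i. if i = 0 then (f ^^ k s t) u else b"]) auto
    have "pseudo_chain f \<delta> (1 + k s t + 1) a b"
      by (rule pseudo_chain_trans[OF pseudo_chain_trans[OF 1 pseudo_chain_orbit[OF refl]] 2])
        (rule \<open>\<delta> > 0\<close>)
    moreover have "k s t \<le> Max ((\<lambda>(s, t). k s t) ` (C \<times> C))"
      using \<open>finite C\<close> s(1) t(1) by (intro Max_ge) (auto intro: rev_image_eqI[of "(s, t)"])
    ultimately show ?thesis unfolding L_def by (intro exI[of _ "1 + k s t + 1"]) simp
  qed
  then show ?thesis by blast
qed

text \<open>A closed chain extends to a periodic pseudo orbit. All shifts of its shadowing orbit by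
  multiples of the period shadow the same sequence, so they lie in one finite dynamical ball, and
  two of them coincide.\<close>

lemma periodic_point_exists:
  assumes "n_expansive f n" "shadowing f" "transitive_map f"
  shows "\<exists>p q. q > 0 \<and> (f ^^ q) p = p"
proof -
  obtain c where c: "c > 0" "\<And>x. finite (stable_set f c x \<inter> unstable_set f c x)"
    using assms(1) unfolding n_expansive_def by blast
  then have "c / 2 > 0" by simp
  obtain \<delta> where "\<delta> > 0" and \<delta>: "\<And>w. (\<And>k. dist (f (w k)) (w (k + 1)) < \<delta>) \<Longrightarrow>
      \<exists>y. \<forall>k. dist (iter_int f k y) (w k) < c / 2"
    by (rule shadowingE[OF assms(2) \<open>c / 2 > 0\<close>]) blast
  obtain l a where "l \<ge> 1" "pseudo_chain f \<delta> l a a"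
    using transitive_bounded_pseudo_chains[OF assms(3) \<open>\<delta> > 0\<close>] by blast
  then obtain u where u: "u 0 = a" "u l = a" "\<And>i. i < l \<Longrightarrow> dist (f (u i)) (u (Suc i)) < \<delta>"
    unfolding pseudo_chain_def by blast
  define w where "w k = u (nat (k mod int l))" for k
  have w_step: "dist (f (w k)) (w (k + 1)) < \<delta>" for k
  proof -
    define i where "i = nat (k mod int l)"
    have "0 \<le> k mod int l" "k mod int l < int l" using \<open>l \<ge> 1\<close> by auto
    then have i: "i < l" "int i = k mod int l" by (auto simp: i_def)
    have "(k + 1) mod int l = (int i + 1) mod int l"
      by (simp add: i(2) mod_add_left_eq)
    also have "\<dots> = int (Suc i mod l)"
      by (simp add: zmod_int add.commute)
    also have "\<dots> = (if Suc i = l then 0 else int i + 1)"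
      using i(1) by auto
    finally have "w (k + 1) = u (Suc i)"
      using u(1,2) by (auto simp: w_def nat_add_distrib)
    then show ?thesis using u(3)[OF i(1)] by (simp add: w_def i_def)
  qed
  obtain y where y: "\<And>k. dist (iter_int f k y) (w k) < c / 2"
    using \<delta>[of w, OF w_step] by blast
  \<comment> \<open>Since \<open>w\<close> has period \<open>l\<close>, the orbits of
    \<open>z j\<close> and \<open>y\<close> are both within \<open>c / 2\<close> of \<open>w\<close>
    at all times, hence within \<open>c\<close> of each other.\<close>
  define z where "z j = iter_int f (int j * int l) y" for j :: nat
  have "z j \<in> stable_set f c y \<inter> unstable_set f c y" for j
  proof -
    have "dist (iter_int f k (z j)) (iter_int f k y) \<le> c" for k
    proof -
      have "w (k + int j * int l) = w k" by (simp add: w_def)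
      then have "dist (iter_int f (k + int j * int l) y) (w k) < c / 2"
        using y[of "k + int j * int l"] by simp
      then have "dist (iter_int f (k + int j * int l) y) (iter_int f k y) < c"
        using dist_triangle_half_l y[of k] by blast
      then show ?thesis by (simp add: z_def iter_int_add)
    qed
    then show ?thesis by (simp add: stable_set_def unstable_set_def)
  qed
  then have "finite (range z)"
    using c(2)[of y] by (meson finite_subset image_subsetI)
  then have "\<not> inj z" using finite_imageD by blast
  then obtain i j where ij: "i < j" "z i = z j"
    by (metis linorder_injI)
  have "iter_int f (int ((j - i) * l)) (z i) = z j"
    using ij(1) by (simp add: z_def flip: iter_int_add)
      (simp add: algebra_simps of_nat_diff)
  then have "(f ^^ ((j - i) * l)) (z i) = z i"
    using ij(2) by (simp only: iter_int_of_nat)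
  moreover have "(j - i) * l > 0" using ij(1) \<open>l \<ge> 1\<close> by simp
  ultimately show ?thesis by blast
qed

text \<open>A chain goes from \<open>a\<close> to the periodic point \<open>p\<close>, waits there
  for whole periods, and goes on to \<open>b\<close>. Only \<open>M0\<close> depends on \<delta>;
  the excess is bounded by the period \<open>q\<close>.\<close>

lemma pseudo_chains_of_almost_any_length:
  assumes "transitive_map f" "q > 0" "(f ^^ q) p = p" "\<delta> > 0"
  shows "\<exists>M0. \<forall>a b. \<forall>M\<ge>M0. \<exists>K\<le>q. pseudo_chain f \<delta> (M + K) a b"
proof -
  obtain L where L: "\<And>a b. \<exists>l\<le>L. pseudo_chain f \<delta> l a b"
    using transitive_bounded_pseudo_chains[OF assms(1,4)] by metis
  have "\<exists>K\<le>q. pseudo_chain f \<delta> (M + K) a b" if "M \<ge> 2 * L" for a b M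
  proof -
    obtain l1 where l1: "l1 \<le> L" "pseudo_chain f \<delta> l1 a p" using L by blast
    obtain l2 where l2: "l2 \<le> L" "pseudo_chain f \<delta> l2 p b" using L by blast
    define R where "R = M - l1 - l2"
    \<comment> \<open>The waiting time \<open>R\<close> is rounded up to the multiple
      \<open>(R div q + 1) * q\<close>, and \<open>K\<close> is the excess.\<close>
    define K where "K = q - R mod q"
    have "pseudo_chain f \<delta> (l1 + (R div q + 1) * q + l2) a b"
      using pseudo_chain_trans[OF pseudo_chain_trans[OF l1(2)
          pseudo_chain_loops[OF pseudo_chain_orbit[OF assms(3,4)]]] l2(2)] .
    moreover have "l1 + (R div q + 1) * q + l2 = M + K"
    proof -
      have "R div q * q + R mod q = R" by simp
      moreover have "R mod q < q" "M = R + l1 + l2"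
        using assms(2) that l1(1) l2(1) by (auto simp: R_def)
      ultimately show ?thesis unfolding K_def by (simp only: add_mult_distrib)
    qed
    ultimately show ?thesis unfolding K_def by (metis diff_le_self)
  qed
  then show ?thesis by blast
qed

section \<open>Connecting the two ends of a limit pseudo orbit\<close>

lemma two_sided_limit_shadowing_gap_of_n_expansive:
  assumes "transitive_map f" "n_expansive f n" "shadowing f"
  shows "two_sided_limit_shadowing_gap f"
proof -
  \<comment> \<open>The period is fixed before the pseudo orbit \<open>x\<close>, so
    \<open>q\<close> is a uniform bound for the gap, although \<open>e\<close>, \<delta> and the
    connecting chain depend on \<open>x\<close>.\<close>
  obtain p q where q: "q > 0" "(f ^^ q) p = p"
    using periodic_point_exists[OF assms(2,3,1)] by blast
  have "\<exists>K. \<bar>K\<bar> \<le> int q \<and> two_sided_limit_shadowed_gap f x K"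
    if po: "two_sided_limit_pseudo_orbit f x" for x
  proof -
    obtain e1 where e1: "e1 > 0" "recurrence_radius f at_top x e1"
      using n_expansive_recurrence_radius[OF assms(2) filterlim_int_shift_at_top] by blast
    obtain e2 where e2: "e2 > 0" "recurrence_radius f at_bot x e2"
      using n_expansive_recurrence_radius[OF assms(2) filterlim_int_shift_at_bot] by blast
    define e where "e = min e1 e2"
    have "e > 0" using e1 e2 by (simp add: e_def)
    have rad: "recurrence_radius f at_top x e" "recurrence_radius f at_bot x e"
      using recurrence_radius_mono[OF e1(2)] recurrence_radius_mono[OF e2(2)]
      by (simp_all add: e_def)
    obtain \<delta> where "\<delta> > 0" and \<delta>: "\<And>w. (\<And>k. dist (f (w k)) (w (k + 1)) < \<delta>) \<Longrightarrow>
        \<exists>y. \<forall>k. dist (iter_int f k y) (w k) < e"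
      by (rule shadowingE[OF assms(3) \<open>e > 0\<close>]) blast
    obtain A B where A: "\<And>k. k \<le> A \<Longrightarrow> dist (f (x k)) (x (k + 1)) < \<delta>"
      and B: "\<And>k. k \<ge> B \<Longrightarrow> dist (f (x k)) (x (k + 1)) < \<delta>"
      by (rule two_sided_limit_pseudo_orbitE[OF po \<open>\<delta> > 0\<close>]) blast
    obtain M0 where M0: "\<And>a b M. M \<ge> M0 \<Longrightarrow> \<exists>K\<le>q. pseudo_chain f \<delta> (M + K) a b"
      using pseudo_chains_of_almost_any_length[OF assms(1) q \<open>\<delta> > 0\<close>] by blast
    \<comment> \<open>Outside \<open>[-m, m)\<close> the jumps of \<open>x\<close> are below
      \<delta>, and adding \<open>M0\<close> makes \<open>2 * m\<close> a permitted chain length up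
      to an excess \<open>K\<close>.\<close>
    define m where "m = nat (max B (- A)) + M0"
    have m: "int m \<ge> B" "- int m \<le> A" by (auto simp: m_def)
    obtain K where "K \<le> q" and "pseudo_chain f \<delta> (2 * m + K) (x (- int m)) (x (int m))"
      using M0[of "2 * m"] by (force simp: m_def)
    then obtain u where u: "u 0 = x (- int m)" "u (2 * m + K) = x (int m)"
      "\<And>i. i < 2 * m + K \<Longrightarrow> dist (f (u i)) (u (Suc i)) < \<delta>"
      unfolding pseudo_chain_def by blast
    \<comment> \<open>The chain takes \<open>2 * m + K\<close> steps where \<open>x\<close> has
      \<open>2 * m\<close>, so the forward part of \<open>x\<close> is delayed by \<open>K\<close>.
      At both seams the adjacent descriptions agree because the chain runs from
      \<open>x (- int m)\<close> to \<open>x (int m)\<close>.\<close>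
    define w where "w k = (if k < - int m then x k else if k < int m + int K
        then u (nat (k + int m)) else x (k - int K))" for k
    have w_bot: "w k = x k" if "k \<le> - int m" for k
    proof (cases "k = - int m")
      case True
      then show ?thesis using u(1,2) by (cases "m = 0 \<and> K = 0") (auto simp: w_def)
    qed (use that in \<open>simp add: w_def\<close>)
    have w_top: "w (k + int K) = x k" if "k \<ge> int m" for k
      using that by (simp add: w_def)
    have w_mid: "w k = u (nat (k + int m))" if "- int m \<le> k" "k \<le> int m + int K" for k
    proof (cases "k = int m + int K")
      case True
      then have "nat (k + int m) = 2 * m + K" by simp
      with True show ?thesis using u(2) by (simp add: w_def)
    qed (use that in \<open>simp add: w_def\<close>)
    have "dist (f (w k)) (w (k + 1)) < \<delta>" for k
    proof -
      consider "k < - int m" | "- int m \<le> k" "k < int m + int K" | "int m + int K \<le> k"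
        by linarith
      then show ?thesis
      proof cases
        case 1
        then show ?thesis using w_bot[of k] w_bot[of "k + 1"] A[of k] m by simp
      next
        case 2
        then have "nat (k + 1 + int m) = Suc (nat (k + int m))" by simp
        with 2 show ?thesis
          using w_mid[of k] w_mid[of "k + 1"] u(3)[of "nat (k + int m)"] by simp
      next
        case 3
        then show ?thesis
          using w_top[of "k - int K"] w_top[of "k - int K + 1"] B[of "k - int K"] m by simp
      qed
    qed
    from \<delta>[of w, OF this] obtain y0 where y0: "\<And>k. dist (iter_int f k y0) (w k) < e" by blast
    have ev_bot: "\<forall>\<^sub>F k in at_bot. w k = x k"
      using eventually_le_at_bot[of "- int m"] by (rule eventually_mono) (rule w_bot)
    have ev_top: "\<forall>\<^sub>F k in at_top. w (k + int K) = x k"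
      using eventually_ge_at_top[of "int m"] by (rule eventually_mono) (rule w_top)
    have "recurrence_radius f at_top w e"
      by (rule recurrence_radius_shift[OF rad(1) ev_top])
    moreover have "recurrence_radius f at_bot w e"
      unfolding recurrence_radius_def
    proof (intro allI impI)
      fix y and \<eta> :: real
      assume "\<forall>\<^sub>F k in at_bot. dist (iter_int f k y) (w k) \<le> e" "0 < \<eta>"
      moreover from this(1) ev_bot have "\<forall>\<^sub>F k in at_bot. dist (iter_int f k y) (x k) \<le> e"
        by eventually_elim simp
      ultimately have "\<exists>\<^sub>F k in at_bot. dist (iter_int f k y) (x k) < \<eta>"
        using rad(2) unfolding recurrence_radius_def by blast
      from frequently_eventually_frequently[OF this ev_bot]
      show "\<exists>\<^sub>F k in at_bot. dist (iter_int f k y) (w k) < \<eta>"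
        by (rule frequently_elim1) simp
    qed
    moreover have "two_sided_limit_pseudo_orbit f w"
      unfolding two_sided_limit_pseudo_orbit_def
    proof
      have "\<forall>\<^sub>F k in at_bot. dist (f (x k)) (x (k + 1)) = dist (f (w k)) (w (k + 1))"
        using eventually_le_at_bot[of "- int m - 1"]
        by (rule eventually_mono) (simp add: w_bot)
      then show "((\<lambda>k. dist (f (w k)) (w (k + 1))) \<longlongrightarrow> 0) at_bot"
        using po unfolding two_sided_limit_pseudo_orbit_def
        by (auto intro: Lim_transform_eventually)
      have "((\<lambda>k. dist (f (x (k + - int K))) (x (k + - int K + 1))) \<longlongrightarrow> 0) at_top"
        using po filterlim_compose[OF _ filterlim_add_const_at_top_int]
        unfolding two_sided_limit_pseudo_orbit_def by fast
      moreover have "\<forall>\<^sub>F k in at_top. dist (f (x (k + - int K))) (x (k + - int K + 1)) =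
          dist (f (w k)) (w (k + 1))"
        using eventually_ge_at_top[of "int m + int K"]
      proof (rule eventually_mono)
        fix k assume "int m + int K \<le> k"
        then show "dist (f (x (k + - int K))) (x (k + - int K + 1)) = dist (f (w k)) (w (k + 1))"
          using w_top[of "k - int K"] w_top[of "k - int K + 1"] by simp
      qed
      ultimately show "((\<lambda>k. dist (f (w k)) (w (k + 1))) \<longlongrightarrow> 0) at_top"
        by (rule Lim_transform_eventually)
    qed
    ultimately obtain y where y: "((\<lambda>k. dist (iter_int f k y) (w k)) \<longlongrightarrow> 0) at_bot"
      "((\<lambda>k. dist (iter_int f k y) (w k)) \<longlongrightarrow> 0) at_top"
      using limit_shadowing_of_recurrence_radius[OF assms(3) _ \<open>e > 0\<close>, of w y0] y0
      by (auto simp: less_imp_le)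
    have "((\<lambda>k. dist (iter_int f k y) (x k)) \<longlongrightarrow> 0) at_bot"
      by (rule Lim_transform_eventually[OF y(1)])
        (use ev_bot in \<open>eventually_elim, simp\<close>)
    \<comment> \<open>Undoing the delay \<open>w (k + int K) = x k\<close> produces the gap
      \<open>K\<close> at the forward end.\<close>
    moreover have "((\<lambda>k. dist (iter_int f (int K + k) y) (x k)) \<longlongrightarrow> 0) at_top"
      by (rule Lim_transform_eventually[OF filterlim_compose[OF y(2)
              filterlim_add_const_at_top_int[of "int K"]]])
        (use ev_top in \<open>eventually_elim, simp add: add.commute\<close>)
    ultimately show ?thesis
      using \<open>K \<le> q\<close> unfolding two_sided_limit_shadowed_gap_def
      by (intro exI[of _ "int K"]) auto
  qed
  then show ?thesis unfolding two_sided_limit_shadowing_gap_def by blast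
qed

end

theorem theorem2p2:
  fixes f :: "'a::metric_space \<Rightarrow> 'a" and n :: nat
  assumes "compact (UNIV :: 'a set)"
    and "\<exists>g. homeomorphism UNIV UNIV f g"
    and "transitive_map f"
    and "n_expansive f n"
    and "shadowing f"
  shows "two_sided_limit_shadowing_gap f"
proof -
  interpret compact_homeo f
    using assms(1,2) by unfold_locales
  show ?thesis
    using two_sided_limit_shadowing_gap_of_n_expansive[OF assms(3-5)] .
qed

end
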